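(* Let $n\ge 2$ and let $\mathcal{D}=(c_{ij})$ be given constants $c_{ij}=c_{ji}\ge 0$, $1\le i<j\le n$. Let $\Pi_{\mathcal{D}}$ be the intersection, in the affine space $\mathcal{K}^n(\mathcal{D})$, of the half-spaces $s_{aJ}\ge 0$, where $J$ varies over all $2^n-2$ proper nonempty subsets of $\{1,\ldots,n\}$. Then, under the identification of a point $(s)\in\mathcal{K}^n(\mathcal{D})$ with $x=(x_1,\ldots,x_n)\in\mathbb{R}^n$ given by $x_i=s_{ai}$, the set $\Pi_{\mathcal{D}}$ is the zonotopal generalized permutohedron $\mathcal{Z}_{\mathcal{D}}$.
   Context: Let $I=\{a,1,2,\ldots,n,b\}$ be an index set with $n+2$ elements. The kinematic space is the real vector space $$\mathcal{K}^n=\Big\{(s_{ij})\in\mathbb{R}^{(n+2)^2}: s_{ii}=0,\ s_{ij}=s_{ji}\ (i,j\in I),\ \sum_{j\in I,\,j\ne i}s_{ij}=0\ \text{for all } i\in I\Big\}.$$ For constants $\mathcal{D}=(c_{ij})$, $c_{ij}=c_{ji}\ge 0$, let $\mathcal{K}^n(\mathcal{D})=\{(s)\in\mathcal{K}^n: s_{ij}=-c_{ij}\text{ for all }1\le i<j\le n\}$. It is an affine space of dimension $n-1$, and its points are determined by the coordinates $x_i=s_{ai}$, $i=1,\dots,n$. For $K\subseteq I$ put $s_K=\sum_{\{i,j\}\subseteq K,\ i\neq j}s_{ij}$ (sum over unordered pairs). For $J\subseteq\{1,\ldots,n\}$, $s_{aJ}$ means $s_{\{a\}\cup J}$. $\mathcal{Z}_{\mathcal{D}}\subset\mathbb{R}^n$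 is the Minkowski sum, over all $1\le i<j\le n$, of the segments $\{c_{ij}(te_i+(1-t)e_j):0\le t\le 1\}$, where $e_1,\ldots,e_n$ is the standard basis of $\mathbb{R}^n$. *)

theory Defs
  imports "HOL-Analysis.Analysis" "HOL-Library.Set_Algebras"
begin

text \<open>
  The labels \<open>1, \<dots>, n\<close> are the elements of a finite linearly ordered type \<open>'n\<close> with
  \<open>CARD('n) = n\<close>.  The index set \<open>I = {a, 1, \<dots>, n, b}\<close> is the following type, ordered as listed.
\<close>

datatype 'n index = IdxA | Lab 'n | IdxB

instance index :: (finite) finite
proof
  have "(UNIV :: 'a index set) = {IdxA, IdxB} \<union> range Lab"
    using index.exhaust by auto
  then show "finite (UNIV :: 'a index set)"
    by (metis finite.emptyI finite.insertI finite_UnI finite_imageI finite)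
qed

instantiation index :: (linorder) linorder
begin

fun less_eq_index :: "'a index \<Rightarrow> 'a index \<Rightarrow> bool" where
  "less_eq_index IdxA _ = True"
| "less_eq_index (Lab i) (Lab j) = (i \<le> j)"
| "less_eq_index _ IdxB = True"
| "less_eq_index _ _ = False"

definition less_index :: "'a index \<Rightarrow> 'a index \<Rightarrow> bool" where
  "less_index i j \<longleftrightarrow> i \<le> j \<and> \<not> j \<le> i"

instance
proof
  fix x y z :: "'a index"
  show "x < y \<longleftrightarrow> x \<le> y \<and> \<not> y \<le> x" by (simp add: less_index_def)
  show "x \<le> x" by (cases x) auto
  show "x \<le> y \<Longrightarrow> y \<le> z \<Longrightarrow> x \<le> z" by (cases x; cases y; cases z) auto
  show "x \<le> y \<Longrightarrow> y \<le> x \<Longrightarrow> x = y" by (cases x; cases y) auto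
  show "x \<le> y \<or> y \<le> x" by (cases x; cases y) auto
qed

end

definition kinematic_space :: "(real ^ ('n::finite) index ^ 'n index) set" where
  "kinematic_space =
     {s. (\<forall>i. s $ i $ i = 0) \<and> (\<forall>i j. s $ i $ j = s $ j $ i)
       \<and> (\<forall>i. (\<Sum>j\<in>UNIV - {i}. s $ i $ j) = 0)}"

definition kinematic_space_at ::
    "('n \<Rightarrow> 'n \<Rightarrow> real) \<Rightarrow> (real ^ ('n::{finite,linorder}) index ^ 'n index) set" where
  "kinematic_space_at c =
     {s \<in> kinematic_space. \<forall>i j. i < j \<longrightarrow> s $ Lab i $ Lab j = - c i j}"

text \<open>The sum over unordered pairs in \<open>K\<close>: each pair is represented once, as \<open>(i, j)\<close> with \<open>i < j\<close>.\<close>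

definition mandelstam ::
    "real ^ ('n::{finite,linorder}) index ^ 'n index \<Rightarrow> 'n index set \<Rightarrow> real" where
  "mandelstam s K = (\<Sum>(i, j) | i \<in> K \<and> j \<in> K \<and> i < j. s $ i $ j)"

definition kinematic_polytope ::
    "('n \<Rightarrow> 'n \<Rightarrow> real) \<Rightarrow> (real ^ ('n::{finite,linorder}) index ^ 'n index) set" where
  "kinematic_polytope c =
     {s \<in> kinematic_space_at c.
        \<forall>J. J \<noteq> {} \<and> J \<noteq> UNIV \<longrightarrow> mandelstam s (insert IdxA (Lab ` J)) \<ge> 0}"

definition x_coords :: "real ^ ('n::finite) index ^ 'n index \<Rightarrow> real ^ 'n" where
  "x_coords s = (\<chi> i. s $ IdxA $ Lab i)"

text \<open>The outer sum is a sum of sets, i.e. the Minkowski sum.\<close>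

definition zonotopal_permutohedron ::
    "('n \<Rightarrow> 'n \<Rightarrow> real) \<Rightarrow> (real ^ ('n::{finite,linorder})) set" where
  "zonotopal_permutohedron c =
     (\<Sum>(i, j) | i < j.
        {c i j *\<^sub>R (t *\<^sub>R axis i 1 + (1 - t) *\<^sub>R axis j 1) | t. 0 \<le> t \<and> t \<le> 1})"

end

theory Submission
  imports Defs
begin

text \<open>
  Write \<open>f J\<close> for the sum of \<open>c i j\<close> over the pairs inside \<open>J\<close>.  In the coordinates \<open>x\<close>, the space
  \<open>kinematic_space_at c\<close> is the hyperplane \<open>x(UNIV) = f UNIV\<close>, and the inequality indexed by \<open>J\<close> is
  \<open>x(J) \<ge> f J\<close>.  Points of the zonotope satisfy these conditions term by term.  Conversely, a
  point outside the zonotope is separated from it by a vector \<open>w\<close>, and the minimum of \<open>w\<close> over the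
  zonotope is the sum of \<open>c i j * min (w i) (w j)\<close>.  Peeling off superlevel sets of \<open>w\<close> one at a
  time, the inequalities for these sets add up to \<open>w \<bullet> x \<ge> (\<Sum>i<j. c i j * min (w i) (w j))\<close>,
  a contradiction.
\<close>

section \<open>Sums over the index set and over pairs of labels\<close>

lemma sum_index_UNIV:
  fixes g :: "('n::finite) index \<Rightarrow> 'b::comm_monoid_add"
  shows "sum g UNIV = g IdxA + g IdxB + (\<Sum>i\<in>UNIV. g (Lab i))"
proof -
  have U: "(UNIV :: 'n index set) = insert IdxA (insert IdxB (range Lab))"
    using index.exhaust by auto
  have "sum g (range Lab) = (\<Sum>i\<in>UNIV. g (Lab i))"
    by (subst sum.reindex) (auto simp: inj_on_def)
  then show ?thesis
    unfolding U by (simp add: image_iff add.assoc)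
qed

text \<open>Bridges the row sums of a matrix, which run over ordered pairs, and the sums over
  \<open>i < j\<close>.\<close>

lemma sum_symmetric_eq_twice:
  fixes g :: "('n::{finite,linorder}) \<Rightarrow> 'n \<Rightarrow> real"
  assumes sym: "\<And>i j. g i j = g j i" and diag: "\<And>i. g i i = 0"
  shows "(\<Sum>i\<in>UNIV. \<Sum>j\<in>UNIV. g i j) = 2 * (\<Sum>(i, j) | i < j. g i j)"
proof -
  have U: "(UNIV :: ('n \<times> 'n) set) = {(i, j). i < j} \<union> ({(i, j). j < i} \<union> {(i, j). i = j})"
    by auto
  have "(\<Sum>i\<in>UNIV. \<Sum>j\<in>UNIV. g i j) = (\<Sum>(i, j)\<in>UNIV. g i j)"
    by (simp add: sum.cartesian_product)
  also have "\<dots> = (\<Sum>(i, j) | i < j. g i j) + ((\<Sum>(i, j) | j < i. g i j) + (\<Sum>(i, j) | i = j. g i j))"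
    unfolding U by (subst sum.union_disjoint, simp, simp, force)
      (subst sum.union_disjoint, auto)
  also have "(\<Sum>(i, j) | i = j. g i j) = 0"
    by (rule sum.neutral) (auto simp: diag)
  also have "(\<Sum>(i, j) | j < i. g i j) = (\<Sum>(i, j) | i < j. g i j)"
    by (rule sum.reindex_bij_witness[of _ prod.swap prod.swap]) (auto simp: sym)
  finally show ?thesis by simp
qed

section \<open>The coordinates \<open>x\<close> on the kinematic space\<close>

lemma kinematic_space_row:
  assumes "s \<in> kinematic_space"
  shows "s $ i $ IdxA + s $ i $ IdxB + (\<Sum>j\<in>UNIV. s $ i $ Lab j) = 0"
proof -
  have "(\<Sum>j\<in>UNIV - {i}. s $ i $ j) = 0" "s $ i $ i = 0"
    using assms by (auto simp: kinematic_space_def)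
  then have "(\<Sum>j\<in>UNIV. s $ i $ j) = 0"
    by (simp add: sum.remove[of UNIV i])
  then show ?thesis
    by (simp add: sum_index_UNIV)
qed

lemma kinematic_space_sym:
  assumes "s \<in> kinematic_space"
  shows "s $ i $ j = s $ j $ i" "s $ i $ i = 0"
  using assms by (auto simp: kinematic_space_def)

lemma kinematic_space_at_Lab:
  fixes c :: "('n::{finite,linorder}) \<Rightarrow> 'n \<Rightarrow> real"
  assumes s: "s \<in> kinematic_space_at c" and sym: "\<And>i j. c i j = c j i"
  shows "s $ Lab i $ Lab j = (if i = j then 0 else - c i j)"
proof -
  have k: "s \<in> kinematic_space" and *: "\<And>i j. i < j \<Longrightarrow> s $ Lab i $ Lab j = - c i j"
    using s by (auto simp: kinematic_space_at_def)
  consider "i < j" | "i = j" | "j < i" by fastforce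
  then show ?thesis
    using * kinematic_space_sym[OF k] sym by cases (force, force, metis less_irrefl)
qed

text \<open>The constants fix the entries between labels and \<open>x_coords\<close> fixes those in
  row \<open>IdxA\<close>; vanishing row sums then force every entry in column
  \<open>IdxB\<close>.\<close>

lemma inj_on_x_coords:
  fixes c :: "('n::{finite,linorder}) \<Rightarrow> 'n \<Rightarrow> real"
  assumes sym: "\<And>i j. c i j = c j i"
  shows "inj_on x_coords (kinematic_space_at c)"
proof (rule inj_onI)
  fix s t assume st: "s \<in> kinematic_space_at c" "t \<in> kinematic_space_at c"
    and eq: "x_coords s = x_coords t"
  then have k: "s \<in> kinematic_space" "t \<in> kinematic_space"
    by (auto simp: kinematic_space_at_def)
  have a: "s $ IdxA $ Lab i = t $ IdxA $ Lab i" for i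
    using eq by (simp add: x_coords_def vec_eq_iff)
  have l: "s $ Lab i $ Lab j = t $ Lab i $ Lab j" for i j
    using st by (simp add: kinematic_space_at_Lab[where c = c, OF _ sym])
  have a': "s $ Lab i $ IdxA = t $ Lab i $ IdxA" for i
    using a[of i] kinematic_space_sym(1)[OF k(1), of "Lab i" IdxA]
      kinematic_space_sym(1)[OF k(2), of "Lab i" IdxA] by simp
  have ab: "s $ IdxA $ IdxB = t $ IdxA $ IdxB"
    using kinematic_space_row[OF k(1), of IdxA] kinematic_space_row[OF k(2), of IdxA]
    by (simp add: a kinematic_space_sym(2) k)
  have lb: "s $ Lab i $ IdxB = t $ Lab i $ IdxB" for i
    using kinematic_space_row[OF k(1), of "Lab i"] kinematic_space_row[OF k(2), of "Lab i"]
    by (simp add: a' l)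
  have "s $ i $ j = t $ i $ j" for i j
    using kinematic_space_sym(1)[OF k(1), of i j] kinematic_space_sym(1)[OF k(2), of i j]
      kinematic_space_sym(2)[OF k(1), of i] kinematic_space_sym(2)[OF k(2), of i]
    by (cases i; cases j) (simp_all add: a a' l ab lb)
  then show "s = t" by (simp add: vec_eq_iff)
qed

section \<open>The subset inequalities in the coordinates \<open>x\<close>\<close>

text \<open>The index set of the sum does not depend on \<open>J\<close>: membership is tested in
  the summand, so that sums for different \<open>J\<close> and sums over the zonotope's segments can
  be compared term by term.\<close>

definition pair_sum :: "('n \<Rightarrow> 'n \<Rightarrow> real) \<Rightarrow> ('n::{finite,linorder}) set \<Rightarrow> real" where
  "pair_sum c J = (\<Sum>(i, j) | i < j. if i \<in> J \<and> j \<in> J then c i j else 0)"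

text \<open>A pair inside the set either contains \<open>IdxA\<close> and contributes a coordinate
  of \<open>x\<close>, or consists of two labels in \<open>J\<close> and contributes minus a
  constant.\<close>

lemma mandelstam_insert_IdxA:
  fixes c :: "('n::{finite,linorder}) \<Rightarrow> 'n \<Rightarrow> real"
  assumes s: "s \<in> kinematic_space_at c"
  shows "mandelstam s (insert IdxA (Lab ` J)) = (\<Sum>i\<in>J. x_coords s $ i) - pair_sum c J"
proof -
  let ?g = "\<lambda>(i, j). s $ i $ j"
  let ?P = "{(i, j). i \<in> J \<and> j \<in> J \<and> i < j}"
  have less: "IdxA < Lab i" "\<not> Lab i < IdxA" "Lab i < Lab j \<longleftrightarrow> i < j" for i j :: 'n
    by (auto simp: less_index_def)
  have split: "{(i, j). i \<in> insert IdxA (Lab ` J) \<and> j \<in> insert IdxA (Lab ` J) \<and> i < j}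
      = (\<lambda>i. (IdxA, Lab i)) ` J \<union> map_prod Lab Lab ` ?P"
    by (auto simp: less)
  have "mandelstam s (insert IdxA (Lab ` J))
      = sum ?g ((\<lambda>i. (IdxA, Lab i)) ` J) + sum ?g (map_prod Lab Lab ` ?P)"
    unfolding mandelstam_def split by (rule sum.union_disjoint) auto
  also have "sum ?g ((\<lambda>i. (IdxA, Lab i)) ` J) = (\<Sum>i\<in>J. x_coords s $ i)"
    by (subst sum.reindex) (auto simp: inj_on_def x_coords_def)
  also have "sum ?g (map_prod Lab Lab ` ?P) = (\<Sum>p\<in>?P. - (case p of (i, j) \<Rightarrow> c i j))"
  proof (subst sum.reindex)
    show "inj_on (map_prod Lab Lab) ?P" by (auto simp: inj_on_def)
    show "sum (?g \<circ> map_prod Lab Lab) ?P = (\<Sum>p\<in>?P. - (case p of (i, j) \<Rightarrow> c i j))"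
      using s by (intro sum.cong) (auto simp: kinematic_space_at_def)
  qed
  also have "\<dots> = - pair_sum c J"
    unfolding pair_sum_def sum_negf neg_equal_iff_equal
    by (rule sum.mono_neutral_cong_left) (auto split: if_splits)
  finally show ?thesis by simp
qed

text \<open>Adding the rows of all labels shows that the \<open>IdxA\<close> and \<open>IdxB\<close>
  columns together sum to twice \<open>pair_sum c UNIV\<close>. Rows \<open>IdxA\<close> and
  \<open>IdxB\<close> show that the two columns have equal sums, both being minus the entry at
  \<open>IdxA\<close>, \<open>IdxB\<close>.\<close>

lemma sum_x_coords:
  fixes c :: "('n::{finite,linorder}) \<Rightarrow> 'n \<Rightarrow> real"
  assumes s: "s \<in> kinematic_space_at c" and sym: "\<And>i j. c i j = c j i"
  shows "(\<Sum>i\<in>UNIV. x_coords s $ i) = pair_sum c UNIV"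
proof -
  have k: "s \<in> kinematic_space"
    using s by (auto simp: kinematic_space_at_def)
  note row = kinematic_space_row[OF k] and sym' = kinematic_space_sym(1)[OF k]
  have "0 = (\<Sum>i\<in>UNIV. s $ Lab i $ IdxA + s $ Lab i $ IdxB + (\<Sum>j\<in>UNIV. s $ Lab i $ Lab j))"
    by (simp add: row)
  also have "\<dots> = (\<Sum>i\<in>UNIV. s $ IdxA $ Lab i) + (\<Sum>i\<in>UNIV. s $ IdxB $ Lab i)
      + (\<Sum>i\<in>UNIV. \<Sum>j\<in>UNIV. s $ Lab i $ Lab j)"
    by (simp add: sum.distrib sym'[of "Lab _" IdxA] sym'[of "Lab _" IdxB])
  also have "(\<Sum>i\<in>UNIV. \<Sum>j\<in>UNIV. s $ Lab i $ Lab j) = 2 * (\<Sum>(i, j) | i < j. s $ Lab i $ Lab j)"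
    by (rule sum_symmetric_eq_twice) (use k in \<open>auto simp: kinematic_space_def\<close>)
  also have "(\<Sum>(i, j) | i < j. s $ Lab i $ Lab j) = (\<Sum>p | fst p < snd p. - c (fst p) (snd p))"
    using s by (intro sum.cong) (auto simp: kinematic_space_at_def)
  also have "\<dots> = - pair_sum c UNIV"
    by (simp add: pair_sum_def sum_negf case_prod_unfold)
  finally show ?thesis
    using row[of IdxA] row[of IdxB] sym'[of IdxB IdxA] kinematic_space_sym(2)[OF k]
    by (simp add: x_coords_def)
qed

lemma kinematic_space_at_exists:
  fixes c :: "('n::{finite,linorder}) \<Rightarrow> 'n \<Rightarrow> real" and x :: "real ^ ('n::{finite,linorder})"
  assumes sym: "\<And>i j. c i j = c j i" and tot: "(\<Sum>i\<in>UNIV. x $ i) = pair_sum c UNIV"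
  obtains s where "s \<in> kinematic_space_at c" "x_coords s = x"
proof -
  \<comment> \<open>The diagonal of \<open>c\<close> is arbitrary, whereas that of \<open>s\<close>
    has to vanish.\<close>
  define d where "d i j = (if i = j then 0 else c i j)" for i j
  \<comment> \<open>\<open>y i\<close> is the entry at \<open>Lab i\<close>, \<open>IdxB\<close>;
    row \<open>Lab i\<close> leaves no other value.\<close>
  define y where "y i = (\<Sum>j\<in>UNIV. d i j) - x $ i" for i
  define g where "g p q = (case (p, q) of
       (IdxA, Lab i) \<Rightarrow> x $ i | (Lab i, IdxA) \<Rightarrow> x $ i
     | (IdxB, Lab i) \<Rightarrow> y i | (Lab i, IdxB) \<Rightarrow> y i
     | (Lab i, Lab j) \<Rightarrow> - d i j
     | (IdxA, IdxB) \<Rightarrow> - (\<Sum>i\<in>UNIV. x $ i) | (IdxB, IdxA) \<Rightarrow> - (\<Sum>i\<in>UNIV. x $ i)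
     | _ \<Rightarrow> 0)" for p q
  define s where "s = (\<chi> p q. g p q)"
  have dsym: "d i j = d j i" for i j by (simp add: d_def sym)
  have "(\<Sum>i\<in>UNIV. \<Sum>j\<in>UNIV. d i j) = 2 * (\<Sum>(i, j) | i < j. d i j)"
    by (rule sum_symmetric_eq_twice) (auto simp: d_def sym)
  also have "(\<Sum>(i, j) | i < j. d i j) = pair_sum c UNIV"
    unfolding pair_sum_def by (rule sum.cong) (auto simp: d_def)
  \<comment> \<open>This is what makes row \<open>IdxB\<close> sum to zero, and the place where
    \<open>tot\<close> is needed.\<close>
  finally have ysum: "(\<Sum>i\<in>UNIV. y i) = (\<Sum>i\<in>UNIV. x $ i)"
    by (simp add: y_def sum_subtractf tot)
  have diag: "g p p = 0" for p
    by (cases p) (auto simp: g_def d_def)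
  have gLab: "g (Lab i) (Lab j) = - c i j" if "i < j" for i j
    using that by (simp add: g_def d_def)
  have gsym: "g p q = g q p" for p q
    by (cases p; cases q) (auto simp: g_def dsym)
  have "(\<Sum>q\<in>UNIV. g p q) = 0" for p
    by (cases p) (auto simp: sum_index_UNIV g_def ysum sum_negf, simp add: y_def)
  then have row: "(\<Sum>q\<in>UNIV - {p}. g p q) = 0" for p
    by (simp add: sum_diff1 diag)
  have "s \<in> kinematic_space_at c"
    unfolding kinematic_space_at_def kinematic_space_def s_def
    using diag gsym row gLab by auto
  moreover have "x_coords s = x"
    by (simp add: x_coords_def s_def g_def vec_eq_iff)
  ultimately show thesis by (rule that)
qed

text \<open>Here \<open>J\<close> ranges over all subsets: the empty set gives
  \<open>0 \<le> 0\<close>, and \<open>UNIV\<close> gives an instance of the equation for the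
  total.\<close>

lemma x_coords_image_kinematic_polytope:
  fixes c :: "('n::{finite,linorder}) \<Rightarrow> 'n \<Rightarrow> real"
  assumes sym: "\<And>i j. c i j = c j i"
  shows "x_coords ` kinematic_polytope c =
    {x. (\<Sum>i\<in>UNIV. x $ i) = pair_sum c UNIV \<and> (\<forall>J. pair_sum c J \<le> (\<Sum>i\<in>J. x $ i))}"
    (is "_ = ?X")
proof (intro equalityI subsetI)
  fix x assume "x \<in> x_coords ` kinematic_polytope c"
  then obtain s where s: "s \<in> kinematic_space_at c" "x = x_coords s"
    and J: "\<And>J. J \<noteq> {} \<Longrightarrow> J \<noteq> UNIV \<Longrightarrow> mandelstam s (insert IdxA (Lab ` J)) \<ge> 0"
    by (auto simp: kinematic_polytope_def)
  have tot: "(\<Sum>i\<in>UNIV. x $ i) = pair_sum c UNIV"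
    using sum_x_coords[of s c, OF s(1) sym] s(2) by simp
  have "pair_sum c J \<le> (\<Sum>i\<in>J. x $ i)" for J
    using J[of J] tot mandelstam_insert_IdxA[OF s(1), of J] s(2)
    by (cases "J = {}"; cases "J = UNIV") (auto simp: pair_sum_def)
  with tot show "x \<in> ?X" by simp
next
  fix x assume x: "x \<in> ?X"
  then obtain s where s: "s \<in> kinematic_space_at c" "x_coords s = x"
    using kinematic_space_at_exists[where c = c, OF sym] by blast
  have "s \<in> kinematic_polytope c"
    using s x by (auto simp: kinematic_polytope_def mandelstam_insert_IdxA)
  with s(2) show "x \<in> x_coords ` kinematic_polytope c" by blast
qed

section \<open>The zonotope: parametrization, convexity, compactness, inequalities\<close>

text \<open>A point of a Minkowski sum chooses a point in each segment independently, so one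
  function \<open>t\<close> on pairs records all the parameters.\<close>

lemma zonotopal_permutohedron_eq:
  "zonotopal_permutohedron c =
    {(\<Sum>(i, j) | i < j. c i j *\<^sub>R (t (i, j) *\<^sub>R axis i 1 + (1 - t (i, j)) *\<^sub>R axis j 1)) | t.
      \<forall>p. 0 \<le> t p \<and> t p \<le> (1::real)}"
  (is "_ = ?Z")
proof (intro equalityI subsetI)
  fix x assume "x \<in> zonotopal_permutohedron c"
  then obtain z where z: "x = sum z {(i, j). i < j}"
    "\<And>i j. i < j \<Longrightarrow>
      \<exists>t. 0 \<le> t \<and> t \<le> 1 \<and> z (i, j) = c i j *\<^sub>R (t *\<^sub>R axis i 1 + (1 - t) *\<^sub>R axis j 1)"
    unfolding zonotopal_permutohedron_def by (subst (asm) set_sum_alt) force+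
  \<comment> \<open>The bounds on \<open>t\<close> are stated for every pair, also those without
    \<open>fst p < snd p\<close>, where any value in the unit interval will do; this yields a total
    choice function.\<close>
  then have "\<forall>p. \<exists>t. 0 \<le> t \<and> t \<le> 1 \<and> (fst p < snd p \<longrightarrow>
      z p = c (fst p) (snd p) *\<^sub>R (t *\<^sub>R axis (fst p) 1 + (1 - t) *\<^sub>R axis (snd p) 1))"
    by (metis prod.collapse zero_le_one order_refl)
  then obtain t where t: "\<forall>p. 0 \<le> t p \<and> t p \<le> 1 \<and> (fst p < snd p \<longrightarrow>
      z p = c (fst p) (snd p) *\<^sub>R (t p *\<^sub>R axis (fst p) 1 + (1 - t p) *\<^sub>R axis (snd p) 1))"
    by metis
  have "x = (\<Sum>(i, j) | i < j. c i j *\<^sub>R (t (i, j) *\<^sub>R axis i 1 + (1 - t (i, j)) *\<^sub>R axis j 1))"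
    unfolding z(1) using t by (intro sum.cong) auto
  with t show "x \<in> ?Z" by blast
next
  fix x assume "x \<in> ?Z"
  then obtain t where t: "\<And>p. 0 \<le> t p \<and> t p \<le> 1" and
    x: "x = (\<Sum>(i, j) | i < j. c i j *\<^sub>R (t (i, j) *\<^sub>R axis i 1 + (1 - t (i, j)) *\<^sub>R axis j 1))"
    by blast
  show "x \<in> zonotopal_permutohedron c"
    unfolding zonotopal_permutohedron_def
    by (subst set_sum_alt) (use t in \<open>force simp: x\<close>)+
qed

lemma compact_set_plus:
  fixes S T :: "'a::real_normed_vector set"
  assumes "compact S" "compact T"
  shows "compact (S + T)"
proof -
  have "S + T = {x + y | x y. x \<in> S \<and> y \<in> T}"
    by (auto simp: set_plus_def)
  then show ?thesis
    using compact_sums[OF assms] by simp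
qed

lemma compact_set_sum:
  fixes S :: "'i \<Rightarrow> 'a::real_normed_vector set"
  assumes "\<And>i. i \<in> I \<Longrightarrow> compact (S i)"
  shows "compact (\<Sum>i\<in>I. S i)"
  using assms
  by (induction I rule: infinite_finite_induct) (auto intro: compact_set_plus)

text \<open>Prepares the separation argument. Closedness is reached through compactness, since sums
  of closed sets need not be closed.\<close>

lemma convex_compact_zonotopal_permutohedron:
  fixes c :: "('n::{finite,linorder}) \<Rightarrow> 'n \<Rightarrow> real"
  shows
  "convex (zonotopal_permutohedron c)" "compact (zonotopal_permutohedron c)"
proof -
  have seg: "{c i j *\<^sub>R (t *\<^sub>R axis i 1 + (1 - t) *\<^sub>R axis j 1) | t. 0 \<le> t \<and> t \<le> 1}
      = closed_segment (c i j *\<^sub>R axis j 1) (c i j *\<^sub>R axis i 1 :: (real, 'n) vec)" for i j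
    unfolding closed_segment_def by (simp add: algebra_simps)
  show "convex (zonotopal_permutohedron c)"
    unfolding zonotopal_permutohedron_def seg by (rule convex_set_sum) auto
  show "compact (zonotopal_permutohedron c)"
    unfolding zonotopal_permutohedron_def seg by (rule compact_set_sum) auto
qed

text \<open>The segment of a pair contributes to the sum over \<open>J\<close> all of
  \<open>c i j\<close> if both ends lie in \<open>J\<close>, and otherwise a nonnegative part of it.
  For \<open>UNIV\<close> the first case always applies.\<close>

lemma zonotopal_permutohedron_inequalities:
  fixes c :: "('n::{finite,linorder}) \<Rightarrow> 'n \<Rightarrow> real"
  assumes nonneg: "\<And>i j. i < j \<Longrightarrow> c i j \<ge> 0" and x: "x \<in> zonotopal_permutohedron c"
  shows "(\<Sum>i\<in>UNIV. x $ i) = pair_sum c UNIV" "pair_sum c J \<le> (\<Sum>i\<in>J. x $ i)"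
proof -
  from x obtain t where t: "\<And>p. 0 \<le> t p \<and> t p \<le> 1" and
    x: "x = (\<Sum>(i, j) | i < j. c i j *\<^sub>R (t (i, j) *\<^sub>R axis i 1 + (1 - t (i, j)) *\<^sub>R axis j 1))"
    unfolding zonotopal_permutohedron_eq by blast
  have J: "(\<Sum>k\<in>J. x $ k) = (\<Sum>(i, j) | i < j.
      c i j * (t (i, j) * of_bool (i \<in> J) + (1 - t (i, j)) * of_bool (j \<in> J)))" for J
  proof -
    have ax: "(\<Sum>k\<in>J. axis i (1::real) $ k) = of_bool (i \<in> J)" for i
      by (simp add: axis_def)
    have "(\<Sum>k\<in>J. x $ k) = (\<Sum>p | fst p < snd p. \<Sum>k\<in>J. c (fst p) (snd p) *
        (t p * axis (fst p) 1 $ k + (1 - t p) * axis (snd p) 1 $ k))"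
      by (subst sum.swap) (simp add: x case_prod_unfold)
    also have "\<dots> = (\<Sum>p | fst p < snd p. c (fst p) (snd p) *
        (t p * of_bool (fst p \<in> J) + (1 - t p) * of_bool (snd p \<in> J)))"
      by (simp add: sum_distrib_left[symmetric] sum.distrib ax)
    finally show ?thesis by (simp add: case_prod_unfold)
  qed
  show "(\<Sum>i\<in>UNIV. x $ i) = pair_sum c UNIV"
    unfolding J pair_sum_def by (rule sum.cong) auto
  show "pair_sum c J \<le> (\<Sum>i\<in>J. x $ i)"
    unfolding J pair_sum_def
  proof (rule sum_mono)
    fix p :: "'n \<times> 'n" assume "p \<in> {(i, j). i < j}"
    then show "(case p of (i, j) \<Rightarrow> if i \<in> J \<and> j \<in> J then c i j else 0)
      \<le> (case p of (i, j) \<Rightarrow> c i j * (t (i, j) * of_bool (i \<in> J) + (1 - t (i, j)) * of_bool (j \<in> J)))"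
      using nonneg t[of p] by auto
  qed
qed

section \<open>Separation: bounding linear functionals from below\<close>

text \<open>Induction on the size of the support \<open>S\<close> of \<open>w\<close>: lowering
  \<open>w\<close> on \<open>S\<close> by its least positive value \<open>m\<close> shrinks the
  support, and \<open>m\<close> times the inequality for \<open>S\<close> pays for the
  change.\<close>

lemma nonneg_weights_pair_min_le:
  fixes c :: "('n::{finite,linorder}) \<Rightarrow> 'n \<Rightarrow> real" and w :: "'n \<Rightarrow> real"
  assumes le: "\<And>J. pair_sum c J \<le> (\<Sum>i\<in>J. x $ i)" and w: "\<And>i. 0 \<le> w i"
  shows "(\<Sum>(i, j) | i < j. c i j * min (w i) (w j)) \<le> (\<Sum>i\<in>UNIV. w i * x $ i)"
  using w
proof (induction "card {i. w i \<noteq> 0}" arbitrary: w rule: less_induct)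
  case less
  define S where "S = {i. w i \<noteq> 0}"
  show ?case
  proof (cases "S = {}")
    case True
    then have "w i = 0" for i by (auto simp: S_def)
    then show ?thesis by simp
  next
    case False
    define m where "m = Min (w ` S)"
    define v where "v i = w i - m * of_bool (i \<in> S)" for i
    have m_le: "m \<le> w i" if "i \<in> S" for i
      using that by (simp add: m_def)
    have "m \<in> w ` S"
      unfolding m_def using False by (intro Min_in) auto
    then obtain k where k: "k \<in> S" "w k = m" by auto
    have m: "m > 0"
      using k less.prems[of k] by (auto simp: S_def)
    have v0: "0 \<le> v i" for i
      using m_le[of i] less.prems[of i] by (simp add: v_def)
    have "{i. v i \<noteq> 0} \<subset> S"
      using k by (auto simp: v_def S_def)
    then have "card {i. v i \<noteq> 0} < card {i. w i \<noteq> 0}"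
      unfolding S_def by (intro psubset_card_mono) auto
    then have IH: "(\<Sum>(i, j) | i < j. c i j * min (v i) (v j)) \<le> (\<Sum>i\<in>UNIV. v i * x $ i)"
      using less.hyps v0 by blast
    \<comment> \<open>If both indices lie in \<open>S\<close>, both weights drop by
      \<open>m\<close>; otherwise one of them is zero before and after, and so are both
      minima.\<close>
    have min_w: "min (w i) (w j) = min (v i) (v j) + m * of_bool (i \<in> S \<and> j \<in> S)" for i j
      using v0[of i] v0[of j] less.prems[of i] less.prems[of j]
      by (auto simp: v_def S_def min_def)
    have "(\<Sum>(i, j) | i < j. c i j * min (w i) (w j))
        = (\<Sum>(i, j) | i < j. c i j * min (v i) (v j)) + m * pair_sum c S"
      unfolding pair_sum_def sum_distrib_left sum.distrib[symmetric]
      by (rule sum.cong) (auto simp: min_w algebra_simps)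
    also have "\<dots> \<le> (\<Sum>i\<in>UNIV. v i * x $ i) + m * (\<Sum>i\<in>S. x $ i)"
      using IH le[of S] m by (intro add_mono mult_left_mono) auto
    also have "(\<Sum>i\<in>S. x $ i) = (\<Sum>i\<in>UNIV. of_bool (i \<in> S) * x $ i)"
      by (rule sum.mono_neutral_cong_left) auto
    also have "(\<Sum>i\<in>UNIV. v i * x $ i) + m * \<dots> = (\<Sum>i\<in>UNIV. w i * x $ i)"
      unfolding sum_distrib_left sum.distrib[symmetric]
      by (rule sum.cong) (auto simp: v_def algebra_simps)
    finally show ?thesis .
  qed
qed

text \<open>Shifting all weights by their minimum makes them nonnegative. By \<open>tot\<close>, the
  shift changes both sides by the same multiple of \<open>pair_sum c UNIV\<close>.\<close>

lemma weights_pair_min_le: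
  fixes c :: "('n::{finite,linorder}) \<Rightarrow> 'n \<Rightarrow> real" and w :: "'n \<Rightarrow> real"
  assumes tot: "(\<Sum>i\<in>UNIV. x $ i) = pair_sum c UNIV"
    and le: "\<And>J. pair_sum c J \<le> (\<Sum>i\<in>J. x $ i)"
  shows "(\<Sum>(i, j) | i < j. c i j * min (w i) (w j)) \<le> (\<Sum>i\<in>UNIV. w i * x $ i)"
proof -
  define m where "m = Min (range w)"
  have "(\<Sum>(i, j) | i < j. c i j * min (w i - m) (w j - m)) \<le> (\<Sum>i\<in>UNIV. (w i - m) * x $ i)"
    by (rule nonneg_weights_pair_min_le[OF le]) (simp add: m_def)
  also have "\<dots> = (\<Sum>i\<in>UNIV. w i * x $ i) - m * pair_sum c UNIV"
    by (simp add: tot[symmetric] left_diff_distrib sum_subtractf sum_distrib_left)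
  also have "(\<Sum>(i, j) | i < j. c i j * min (w i - m) (w j - m))
      = (\<Sum>(i, j) | i < j. c i j * min (w i) (w j)) - m * pair_sum c UNIV"
    unfolding pair_sum_def sum_distrib_left sum_subtractf[symmetric]
    by (rule sum.cong) (auto simp: min_def algebra_simps)
  finally show ?thesis by simp
qed

lemma zonotopal_permutohedron_support:
  fixes c :: "('n::{finite,linorder}) \<Rightarrow> 'n \<Rightarrow> real" and w :: "real ^ ('n::{finite,linorder})"
  obtains z where "z \<in> zonotopal_permutohedron c"
    "w \<bullet> z = (\<Sum>(i, j) | i < j. c i j * min (w $ i) (w $ j))"
proof -
  \<comment> \<open>On each segment this picks the endpoint of smaller weight, where the functional
    \<open>w\<close> yields \<open>c i j * min (w $ i) (w $ j)\<close>.\<close>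
  define t where "t p = (of_bool (w $ fst p \<le> w $ snd p) :: real)" for p
  let ?z = "\<Sum>(i, j) | i < j. c i j *\<^sub>R (t (i, j) *\<^sub>R axis i 1 + (1 - t (i, j)) *\<^sub>R axis j 1)"
  have "?z \<in> zonotopal_permutohedron c"
    unfolding zonotopal_permutohedron_eq
    by (rule CollectI, rule exI[of _ t]) (simp add: t_def)
  moreover have "w \<bullet> ?z = (\<Sum>(i, j) | i < j. c i j * min (w $ i) (w $ j))"
    unfolding inner_sum_right
    by (rule sum.cong) (auto simp: t_def inner_axis inner_add_right min_def)
  ultimately show thesis by (rule that)
qed

lemma zonotopal_permutohedron_eq_inequalities:
  fixes c :: "('n::{finite,linorder}) \<Rightarrow> 'n \<Rightarrow> real"
  assumes nonneg: "\<And>i j. i < j \<Longrightarrow> c i j \<ge> 0"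
  shows "zonotopal_permutohedron c =
    {x. (\<Sum>i\<in>UNIV. x $ i) = pair_sum c UNIV \<and> (\<forall>J. pair_sum c J \<le> (\<Sum>i\<in>J. x $ i))}"
    (is "_ = ?X")
proof (intro equalityI subsetI)
  fix x assume "x \<in> zonotopal_permutohedron c"
  then show "x \<in> ?X"
    using zonotopal_permutohedron_inequalities[OF nonneg] by auto
next
  fix x assume x: "x \<in> ?X"
  show "x \<in> zonotopal_permutohedron c"
  proof (rule ccontr)
    assume "x \<notin> zonotopal_permutohedron c"
    then obtain w b where wb: "w \<bullet> x < b" "\<forall>z\<in>zonotopal_permutohedron c. w \<bullet> z > b"
      using separating_hyperplane_closed_point convex_compact_zonotopal_permutohedron
        compact_imp_closed by metis
    obtain z where "z \<in> zonotopal_permutohedron c"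
      "w \<bullet> z = (\<Sum>(i, j) | i < j. c i j * min (w $ i) (w $ j))"
      by (rule zonotopal_permutohedron_support)
    moreover have "(\<Sum>(i, j) | i < j. c i j * min (w $ i) (w $ j)) \<le> w \<bullet> x"
      using weights_pair_min_le[of x c "($) w"] x by (simp add: inner_vec_def)
    ultimately show False using wb by force
  qed
qed

theorem theorem8:
  fixes c :: "('n::{finite,linorder}) \<Rightarrow> 'n \<Rightarrow> real"
  assumes "CARD('n) \<ge> 2"
    and "\<And>i j. c i j = c j i"
    and "\<And>i j. i < j \<Longrightarrow> c i j \<ge> 0"
  shows "inj_on x_coords (kinematic_space_at c)
    \<and> x_coords ` kinematic_polytope c = zonotopal_permutohedron c"
  using assms(2,3)
  by (simp add: inj_on_x_coords x_coords_image_kinematic_polytope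
      zonotopal_permutohedron_eq_inequalities)

end
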